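(* For all zones $m\in\{1,\ldots,M\}$, times $\tau\ge0$, agents $n\in\mathcal V$ and $t\ge\tau$, the gossip estimate $\hat R_{m,\tau,n,t}$ underestimates the global reward, i.e., $\hat R_{m,\tau,n,t}\le r_m(S_\tau,A_\tau)$, with equality if the gossiping time is large enough: $$\hat R_{m,\tau,n,t}=r_m(S_\tau,A_\tau)\quad\text{for all }n\in\mathcal V\text{ and }t\ge\tau+d(\mathcal G).$$
   Context: $N$ agents have states $S_{tn}\in\mathcal S$ ($n=1,\ldots,N$, $t=0,1,\ldots$), and $S_t=(S_{t1},\ldots,S_{tN})$, $A_t$ denote the joint state and action. Given regions $\mathcal S_1,\ldots,\mathcal S_M\subset\mathcal S$, the reward is $r_m(S_t,A_t)=\max_{n=1,\ldots,N}\mathbf 1[S_{tn}\in\mathcal S_m]\in\{0,1\}$. The agents are the nodes $\mathcal V=\{1,\ldots,N\}$ of a connected communication graph $\mathcal G(\mathcal V,\mathcal E)$; $\mathcal N_n$ is the set of neighbors of $n$, and $d(\mathcal G)$ is the graph diameter, i.e., the maximum over pairs of nodes of the minimum number of hops between them. For each $m$ and $\tau$, agent $n$ computes the gossip estimates of $r_m(S_\tau,A_\tau)$ by $$\hat R_{m,\tau,n,\tau}=\mathbf 1[S_{\tau n}\in\mathcal S_m],\qquad \hat R_{m,\tau,n,t}=\max_{i\in\mathcal N_n\cup\{n\}}\hat R_{m,\tau,i,t-1}\quad\text{for }t>\tau.$$ *)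

theory Defs
  imports "Graph_Theory.Graph_Theory" "HOL-Library.Indicator_Function"
begin

text \<open>
  The communication graph is a graph in the sense of the locale \<^locale>\<open>graph\<close>, that is, a finite
  symmetric digraph without loops and parallel arcs: an undirected edge is a pair of opposite arcs.
\<close>

definition neighbors :: "('v, 'e) pre_digraph \<Rightarrow> 'v \<Rightarrow> 'v set" where
  "neighbors G n = {i. n \<rightarrow>\<^bsub>G\<^esub> i}"

text \<open>
  Hop distance and diameter are meaningful for finite, nonempty, connected graphs only. A walk is
  given by its list of arcs, so its length is its number of hops, and the empty walk has length 0.
\<close>

definition hop_dist :: "('v, 'e) pre_digraph \<Rightarrow> 'v \<Rightarrow> 'v \<Rightarrow> nat" where
  "hop_dist G u v = (LEAST k. \<exists>p. pre_digraph.awalk G u p v \<and> length p = k)"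

definition graph_diameter :: "('v, 'e) pre_digraph \<Rightarrow> nat" where
  "graph_diameter G = Max {hop_dist G u v | u v. u \<in> verts G \<and> v \<in> verts G}"

text \<open>
  A joint state maps each agent in \<open>{1..N}\<close> to its state; its values at other indices are irrelevant.
  The reward has a joint action as an argument but does not depend on it.
\<close>

definition reward :: "nat \<Rightarrow> (nat \<Rightarrow> 's set) \<Rightarrow> nat \<Rightarrow> (nat \<Rightarrow> 's) \<Rightarrow> 'a \<Rightarrow> real" where
  "reward N Z m s a = (MAX n\<in>{1..N}. indicator (Z m) (s n))"

text \<open>
  Here \<open>S \<tau> n\<close> is the state of agent \<open>n\<close> at time \<open>\<tau>\<close>. The estimate is meant for \<open>\<tau> \<le> t\<close>;
  for \<open>t < \<tau>\<close> it takes the initial value by convention.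
\<close>

fun gossip :: "('v, 'e) pre_digraph \<Rightarrow> (nat \<Rightarrow> 's set) \<Rightarrow> (nat \<Rightarrow> 'v \<Rightarrow> 's)
    \<Rightarrow> nat \<Rightarrow> nat \<Rightarrow> 'v \<Rightarrow> nat \<Rightarrow> real" where
  "gossip G Z S m \<tau> n t =
     (if t \<le> \<tau> then indicator (Z m) (S \<tau> n)
      else (MAX i\<in>neighbors G n \<union> {n}. gossip G Z S m \<tau> i (t - 1)))"

declare gossip.simps [simp del]

end

theory Submission
  imports Defs
begin

text \<open>
  Each gossip step carries information across one arc. After \<open>k\<close> steps the estimate of \<open>n\<close> therefore
  dominates the indicator of every agent within \<open>k\<close> hops of \<open>n\<close>. After as many steps as the diameter,
  this includes an agent at which the reward is attained.
\<close>

lemma (in fin_digraph) finite_neighbors: "finite (neighbors G n)"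
  by (rule finite_subset[OF _ finite_verts]) (auto simp: neighbors_def)

lemma (in wf_digraph) neighbors_subset_verts: "neighbors G n \<subseteq> verts G"
  by (auto simp: neighbors_def)

lemma indicator_le_reward:
  assumes "n \<in> {1..N}"
  shows "indicator (Z m) (s n) \<le> reward N Z m s a"
  unfolding reward_def using assms by (intro Max_ge) auto

lemma reward_attained:
  assumes "N \<ge> 1"
  obtains n where "n \<in> {1..N}" "reward N Z m s a = indicator (Z m) (s n)"
proof -
  have "reward N Z m s a \<in> (\<lambda>n. indicator (Z m) (s n)) ` {1..N}"
    unfolding reward_def using assms by (intro Max_in) auto
  then show ?thesis
    using that by blast
qed

lemma gossip_start: "gossip G Z S m \<tau> n \<tau> = indicator (Z m) (S \<tau> n)"
  by (simp add: gossip.simps)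

text \<open>Counting time as an offset from \<open>\<tau>\<close> turns the recursion on absolute
  time into one on the number of rounds \<open>k\<close>, the induction variable of both bounds
  below.\<close>

lemma gossip_Suc:
  "gossip G Z S m \<tau> n (\<tau> + Suc k) = (MAX i\<in>neighbors G n \<union> {n}. gossip G Z S m \<tau> i (\<tau> + k))"
  by (subst gossip.simps) simp

text \<open>Taking maxima never exceeds a common bound, and closed neighborhoods of vertices stay
  inside \<open>verts G\<close>.\<close>

lemma (in fin_digraph) gossip_le:
  assumes "n \<in> verts G" and "\<And>i. i \<in> verts G \<Longrightarrow> indicator (Z m) (S \<tau> i) \<le> r"
  shows "gossip G Z S m \<tau> n (\<tau> + k) \<le> r"
  using assms(1)
proof (induction k arbitrary: n)
  case 0
  then show ?case
    using assms(2) by (simp add: gossip_start)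
next
  case (Suc k)
  then show ?case
    using neighbors_subset_verts finite_neighbors unfolding gossip_Suc by (subst Max_le_iff) auto
qed

text \<open>The first arc of the walk leads to a neighbor of \<open>n\<close>, from which one hop
  fewer remains; hence \<open>n\<close> and \<open>p\<close> vary in the induction. Allowing
  \<open>length p \<le> k\<close> rather than equality covers all times beyond the diameter.\<close>

lemma (in fin_digraph) gossip_ge_if_awalk:
  assumes "awalk n p v" "length p \<le> k"
  shows "indicator (Z m) (S \<tau> v) \<le> gossip G Z S m \<tau> n (\<tau> + k)"
  using assms
proof (induction k arbitrary: n p)
  case 0
  then show ?case
    by (auto simp: gossip_start awalk_Nil_iff)
next
  case (Suc k)
  \<comment> \<open>An empty walk has no first arc to follow: the step is then spent waiting at \<open>n\<close> itself.\<close>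
  obtain i q where i: "i \<in> neighbors G n \<union> {n}" and q: "awalk i q v" "length q \<le> k"
  proof (cases p)
    case Nil
    then show ?thesis
      using that[of n "[]"] Suc.prems by simp
  next
    case (Cons e q)
    then show ?thesis
      using that[of "head G e" q] Suc.prems
      by (auto simp: awalk_Cons_iff neighbors_def intro: in_arcs_imp_in_arcs_ends)
  qed
  have "indicator (Z m) (S \<tau> v) \<le> gossip G Z S m \<tau> i (\<tau> + k)"
    using Suc.IH[OF q] .
  also have "\<dots> \<le> gossip G Z S m \<tau> n (\<tau> + Suc k)"
    unfolding gossip_Suc using i finite_neighbors by (intro Max_ge) auto
  finally show ?case .
qed

lemma (in fin_digraph) awalk_length_le_diameter:
  assumes "u \<rightarrow>\<^sup>*\<^bsub>G\<^esub> v"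
  obtains p where "awalk u p v" "length p \<le> graph_diameter G"
proof -
  have "\<exists>k p. awalk u p v \<and> length p = k"
    using assms by (auto simp: reachable_awalk)
  \<comment> \<open>Reachability provides some walk, so the \<open>LEAST\<close> in
    \<open>hop_dist\<close> is attained.\<close>
  then have "\<exists>p. awalk u p v \<and> length p = hop_dist G u v"
    unfolding hop_dist_def by (rule LeastI_ex)
  moreover have "hop_dist G u v \<le> graph_diameter G"
    unfolding graph_diameter_def
  proof (rule Max_ge)
    show "finite {hop_dist G u v |u v. u \<in> verts G \<and> v \<in> verts G}"
      by (rule finite_image_set2) auto
    show "hop_dist G u v \<in> {hop_dist G u v |u v. u \<in> verts G \<and> v \<in> verts G}"
      using reachable_in_verts[OF assms] by blast
  qed
  ultimately show ?thesis
    using that by metis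
qed

theorem lemma2:
  fixes N M :: nat
    and G :: "(nat, 'e) pre_digraph"
    and S :: "nat \<Rightarrow> nat \<Rightarrow> 's"
    and A :: "nat \<Rightarrow> 'a"
    and Z :: "nat \<Rightarrow> 's set"
  assumes "graph G"
    and "Digraph_Component.connected G"
    and "verts G = {1..N}"
  shows "\<forall>m\<in>{1..M}. \<forall>\<tau>.
    (\<forall>n\<in>verts G. \<forall>t\<ge>\<tau>. gossip G Z S m \<tau> n t \<le> reward N Z m (S \<tau>) (A \<tau>)) \<and>
    (\<forall>n\<in>verts G. \<forall>t\<ge>\<tau> + graph_diameter G. gossip G Z S m \<tau> n t = reward N Z m (S \<tau>) (A \<tau>))"
proof (intro ballI allI conjI impI)
  interpret graph G by fact
  fix m \<tau> n t
  assume n: "n \<in> verts G"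
  have upper: "gossip G Z S m \<tau> n t \<le> reward N Z m (S \<tau>) (A \<tau>)" if "t \<ge> \<tau>" for t
    using gossip_le[OF n, of Z m S \<tau> "reward N Z m (S \<tau>) (A \<tau>)" "t - \<tau>"] that assms(3)
    by (simp add: indicator_le_reward)
  then show "gossip G Z S m \<tau> n t \<le> reward N Z m (S \<tau>) (A \<tau>)" if "t \<ge> \<tau>"
    using that by blast
  show "gossip G Z S m \<tau> n t = reward N Z m (S \<tau>) (A \<tau>)" if t: "t \<ge> \<tau> + graph_diameter G"
  proof (rule antisym)
    show "gossip G Z S m \<tau> n t \<le> reward N Z m (S \<tau>) (A \<tau>)"
      using upper t by simp
    \<comment> \<open>The vertex \<open>n\<close> itself witnesses \<open>N \<ge> 1\<close>, so the
      reward is a maximum over a nonempty set.\<close>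
    obtain v where v: "v \<in> verts G" "reward N Z m (S \<tau>) (A \<tau>) = indicator (Z m) (S \<tau> v)"
      using reward_attained[of N Z m "S \<tau>" "A \<tau>"] n assms(3) by auto
    \<comment> \<open>Connectedness concerns the symmetric closure; as the arcs of \<open>G\<close>
      are symmetric, it gives directed reachability, here from the receiving agent \<open>n\<close>
      to the agent \<open>v\<close> attaining the reward.\<close>
    have "n \<rightarrow>\<^sup>*\<^bsub>G\<^esub> v"
      using symmetric_connected_imp_strongly_connected[OF sym_arcs assms(2)] n v(1) by blast
    then obtain p where "awalk n p v" "length p \<le> graph_diameter G"
      by (rule awalk_length_le_diameter)
    then show "reward N Z m (S \<tau>) (A \<tau>) \<le> gossip G Z S m \<tau> n t"
      using gossip_ge_if_awalk[of n p v "t - \<tau>" Z m S \<tau>] v(2) t by simp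
  qed
qed

end
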